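(* For every integer $d \geq 1$, the Ehrhart polynomial $E_{\mathrm{St}_d^\ast}(n)$ of the $d$-dimensional Stasheff polytope $$\mathrm{St}_d^\ast = \{(x_1,\ldots,x_d)\in\mathbb{R}^d \mid -1\le x_i\le 1 \ (1\le i\le d),\ x_j+\cdots+x_k\le 1\ (1\le j<k\le d)\}$$ is magic positive.
   Context: For a lattice polytope $P\subset\mathbb{R}^d$, its Ehrhart polynomial $E_P(n)$ is the polynomial with $E_P(n)=|nP\cap\mathbb{Z}^d|$ for all integers $n>0$. The polytope $\mathrm{St}_d^\ast$ is the polar dual $\{y\in\mathbb{R}^d\mid \langle x,y\rangle\le 1 \ \forall x\in \mathrm{St}_d\}$ of $\mathrm{St}_d=\mathrm{conv}(\{\pm\mathbf{e}_i: 1\le i\le d\}\cup\{\mathbf{e}_i+\cdots+\mathbf{e}_j : 1\le i<j\le d\})$ (the Stasheff polytope/associahedron); it is a reflexive lattice polytope. A polynomial $f(n)$ of degree at most $d$ is called magic positive (with respect to $d$) if, writing $f(n)=\sum_{i=0}^d a_i n^i(1+n)^{d-i}$ with real $a_i$, one has $a_0,\ldots,a_d\ge 0$. *)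

theory Defs
  imports Complex_Main "HOL-Computational_Algebra.Polynomial"
begin

text \<open>
  The dimension \<open>d\<close> is a natural number that varies inside the statement, so \<open>\<real>\<^sup>d\<close> is modelled as the
  space of functions \<open>nat \<Rightarrow> real\<close> that vanish outside the index set \<open>{1..d}\<close>.
\<close>

definition Rspace :: "nat \<Rightarrow> (nat \<Rightarrow> real) set" where
  "Rspace d = {x. \<forall>i. i \<notin> {1..d} \<longrightarrow> x i = 0}"

definition Zlattice :: "nat \<Rightarrow> (nat \<Rightarrow> real) set" where
  "Zlattice d = {x \<in> Rspace d. \<forall>i\<in>{1..d}. x i \<in> \<int>}"

definition dilate :: "real \<Rightarrow> (nat \<Rightarrow> real) set \<Rightarrow> (nat \<Rightarrow> real) set" where
  "dilate c P = (\<lambda>x i. c * x i) ` P"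

definition is_ehrhart_polynomial :: "nat \<Rightarrow> (nat \<Rightarrow> real) set \<Rightarrow> real poly \<Rightarrow> bool" where
  "is_ehrhart_polynomial d P p \<longleftrightarrow>
     (\<forall>n::nat. n > 0 \<longrightarrow> poly p (real n) = real (card (dilate (real n) P \<inter> Zlattice d)))"

definition ehrhart_polynomial :: "nat \<Rightarrow> (nat \<Rightarrow> real) set \<Rightarrow> real poly" where
  "ehrhart_polynomial d P = (THE p. is_ehrhart_polynomial d P p)"

text \<open>In the next definition \<open>monom 1 i\<close> is \<open>n\<^sup>i\<close> and \<open>[:1, 1:]\<close> is \<open>1 + n\<close>.\<close>

definition magic_positive :: "nat \<Rightarrow> real poly \<Rightarrow> bool" where
  "magic_positive d f \<longleftrightarrow> degree f \<le> d \<and>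
     (\<exists>a :: nat \<Rightarrow> real.
        f = (\<Sum>i\<le>d. smult (a i) (monom 1 i * [:1, 1:] ^ (d - i))) \<and> (\<forall>i\<le>d. a i \<ge> 0))"

definition stasheff_dual :: "nat \<Rightarrow> (nat \<Rightarrow> real) set" where
  "stasheff_dual d = {x \<in> Rspace d.
     (\<forall>i. 1 \<le> i \<and> i \<le> d \<longrightarrow> -1 \<le> x i \<and> x i \<le> 1) \<and>
     (\<forall>j k. 1 \<le> j \<and> j < k \<and> k \<le> d \<longrightarrow> (\<Sum>i=j..k. x i) \<le> 1)}"


lemma is_ehrhart_polynomial_unique:
  assumes "is_ehrhart_polynomial d P p" "is_ehrhart_polynomial d P q"
  shows "p = q"
proof (rule ccontr)
  assume "p \<noteq> q"
  then have fin: "finite {x. poly (p - q) x = 0}"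
    by (intro poly_roots_finite) simp
  have "real ` {0<..} \<subseteq> {x. poly (p - q) x = 0}"
    using assms by (auto simp: is_ehrhart_polynomial_def)
  then have "finite (real ` {0<..})"
    using fin by (rule finite_subset)
  then have "finite {0::nat<..}"
    by (rule finite_imageD) (simp add: inj_on_def)
  then show False
    by (simp add: infinite_Ioi)
qed

lemma ehrhart_polynomial_eqI:
  assumes "is_ehrhart_polynomial d P p"
  shows "ehrhart_polynomial d P = p"
  unfolding ehrhart_polynomial_def
  using assms is_ehrhart_polynomial_unique by blast

lemma finite_dilate_stasheff_dual_lattice:
  "finite (dilate (real n) (stasheff_dual d) \<inter> Zlattice d)"
proof -
  let ?I = "real_of_int ` {- int n..int n}"
  let ?F = "{f. \<forall>i. (i \<in> {1..d} \<longrightarrow> f i \<in> ?I) \<and> (i \<notin> {1..d} \<longrightarrow> f i = 0)}"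
  have "finite ?F"
    by (rule finite_set_of_finite_funs) auto
  moreover have "y \<in> ?F" if y: "y \<in> dilate (real n) (stasheff_dual d)" "y \<in> Zlattice d" for y
  proof -
    obtain x where x: "x \<in> stasheff_dual d" "y = (\<lambda>i. real n * x i)"
      using y(1) by (auto simp: dilate_def)
    have "y i \<in> ?I" if i: "i \<in> {1..d}" for i
    proof -
      have "y i \<in> \<int>"
        using y(2) i by (simp add: Zlattice_def)
      then obtain m where m: "y i = real_of_int m"
        by (rule Ints_cases)
      have "-1 \<le> x i" "x i \<le> 1"
        using x(1) i by (auto simp: stasheff_dual_def)
      then have "real n * (-1) \<le> real n * x i" "real n * x i \<le> real n * 1"
        by (intro mult_left_mono; simp)+
      then have "real_of_int (- int n) \<le> real_of_int m" "real_of_int m \<le> real_of_int (int n)"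
        using m x(2) by simp_all
      then show ?thesis
        using m by (metis atLeastAtMost_iff image_eqI of_int_le_iff)
    qed
    then show ?thesis
      using y(2) by (auto simp: Zlattice_def Rspace_def)
  qed
  ultimately show ?thesis
    by (meson IntE finite_subset subsetI)
qed

text \<open>
  \<open>stasheff_dual d\<close> is the polar dual of the convex hull of the vectors \<open>\<plusminus>e\<^sub>i\<close> and \<open>e\<^sub>i + \<dots> + e\<^sub>j\<close>.
  Function spaces are not an instance of \<open>real_vector\<close>, so convexity is spelled out here in the form
  of the library's \<open>convex\<close>.
\<close>

definition fconvex :: "(nat \<Rightarrow> real) set \<Rightarrow> bool" where
  "fconvex S \<longleftrightarrow> (\<forall>x\<in>S. \<forall>y\<in>S. \<forall>u\<ge>0. \<forall>v\<ge>0. u + v = 1 \<longrightarrow> (\<lambda>i. u * x i + v * y i) \<in> S)"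

definition unit_vector :: "nat \<Rightarrow> nat \<Rightarrow> real" where
  "unit_vector i = (\<lambda>k. if k = i then 1 else 0)"

definition polar_dual :: "nat \<Rightarrow> (nat \<Rightarrow> real) set \<Rightarrow> (nat \<Rightarrow> real) set" where
  "polar_dual d S = {y \<in> Rspace d. \<forall>x\<in>S. (\<Sum>i=1..d. x i * y i) \<le> 1}"

definition stasheff_vertices :: "nat \<Rightarrow> (nat \<Rightarrow> real) set" where
  "stasheff_vertices d =
     {unit_vector i | i. 1 \<le> i \<and> i \<le> d} \<union> {\<lambda>k. - unit_vector i k | i. 1 \<le> i \<and> i \<le> d} \<union>
     {\<lambda>k. \<Sum>l=i..j. unit_vector l k | i j. 1 \<le> i \<and> i < j \<and> j \<le> d}"

definition stasheff :: "nat \<Rightarrow> (nat \<Rightarrow> real) set" where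
  "stasheff d = fconvex hull stasheff_vertices d"

lemma polar_dual_hull: "polar_dual d (fconvex hull V) = polar_dual d V"
proof -
  have "(\<Sum>i=1..d. x i * y i) \<le> 1"
    if V: "\<forall>x\<in>V. (\<Sum>i=1..d. x i * y i) \<le> 1" and x: "x \<in> fconvex hull V" for x y
  proof -
    have "fconvex {x. (\<Sum>i=1..d. x i * y i) \<le> 1}"
      unfolding fconvex_def
    proof (intro ballI allI impI)
      fix a b and u v :: real
      assume *: "a \<in> {x. (\<Sum>i=1..d. x i * y i) \<le> 1}" "b \<in> {x. (\<Sum>i=1..d. x i * y i) \<le> 1}"
        "0 \<le> u" "0 \<le> v" "u + v = 1"
      have "(\<Sum>i=1..d. (u * a i + v * b i) * y i) =
          u * (\<Sum>i=1..d. a i * y i) + v * (\<Sum>i=1..d. b i * y i)"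
        by (simp add: sum_distrib_left sum.distrib algebra_simps)
      also have "\<dots> \<le> u * 1 + v * 1"
        using * by (intro add_mono mult_left_mono) auto
      finally show "(\<lambda>i. u * a i + v * b i) \<in> {x. (\<Sum>i=1..d. x i * y i) \<le> 1}"
        using * by simp
    qed
    then have "fconvex hull V \<subseteq> {x. (\<Sum>i=1..d. x i * y i) \<le> 1}"
      using V by (intro hull_minimal) auto
    then show ?thesis
      using x by auto
  qed
  moreover have "V \<subseteq> fconvex hull V"
    by (rule hull_subset)
  ultimately show ?thesis
    unfolding polar_dual_def by blast
qed

lemma stasheff_dual_eq_polar_dual: "stasheff_dual d = polar_dual d (stasheff d)"
proof -
  have e: "(\<Sum>k=1..d. unit_vector i k * y k) = y i" if "1 \<le> i" "i \<le> d" for i and y :: "nat \<Rightarrow> real"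
    using that by (simp add: unit_vector_def if_distrib[of "\<lambda>t. t * _"] cong: if_cong)
  have s: "(\<Sum>k=1..d. (\<Sum>l=i..j. unit_vector l k) * y k) = (\<Sum>l=i..j. y l)"
    if "1 \<le> i" "j \<le> d" for i j and y :: "nat \<Rightarrow> real"
  proof -
    have "(\<Sum>k=1..d. (\<Sum>l=i..j. unit_vector l k) * y k) =
        (\<Sum>l=i..j. \<Sum>k=1..d. unit_vector l k * y k)"
      unfolding sum_distrib_right by (rule sum.swap)
    also have "\<dots> = (\<Sum>l=i..j. y l)"
      using that by (intro sum.cong refl e) auto
    finally show ?thesis .
  qed
  have n: "(\<Sum>k=1..d. - unit_vector i k * y k) = - y i" if "1 \<le> i" "i \<le> d" for i and y :: "nat \<Rightarrow> real"
    using e[OF that, of y] by (simp add: sum_negf)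
  have "(\<forall>x\<in>stasheff_vertices d. (\<Sum>k=1..d. x k * y k) \<le> 1) \<longleftrightarrow>
      (\<forall>i. 1 \<le> i \<and> i \<le> d \<longrightarrow> -1 \<le> y i \<and> y i \<le> 1) \<and>
      (\<forall>i j. 1 \<le> i \<and> i < j \<and> j \<le> d \<longrightarrow> (\<Sum>l=i..j. y l) \<le> 1)" for y
  proof -
    have c1: "(\<forall>x\<in>{f i | i. P i}. Q x) \<longleftrightarrow> (\<forall>i. P i \<longrightarrow> Q (f i))"
      for f :: "nat \<Rightarrow> nat \<Rightarrow> real" and P Q
      by blast
    have c2: "(\<forall>x\<in>{f i j | i j. P i j}. Q x) \<longleftrightarrow> (\<forall>i j. P i j \<longrightarrow> Q (f i j))"
      for f :: "nat \<Rightarrow> nat \<Rightarrow> nat \<Rightarrow> real" and P Q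
      by blast
    have "(\<forall>x\<in>stasheff_vertices d. (\<Sum>k=1..d. x k * y k) \<le> 1) \<longleftrightarrow>
        (\<forall>i. 1 \<le> i \<and> i \<le> d \<longrightarrow> (\<Sum>k=1..d. unit_vector i k * y k) \<le> 1) \<and>
        (\<forall>i. 1 \<le> i \<and> i \<le> d \<longrightarrow> (\<Sum>k=1..d. - unit_vector i k * y k) \<le> 1) \<and>
        (\<forall>i j. 1 \<le> i \<and> i < j \<and> j \<le> d \<longrightarrow>
          (\<Sum>k=1..d. (\<Sum>l=i..j. unit_vector l k) * y k) \<le> 1)"
      unfolding stasheff_vertices_def by (simp only: ball_Un c1 c2 conj_assoc)
    also have "\<dots> \<longleftrightarrow> (\<forall>i. 1 \<le> i \<and> i \<le> d \<longrightarrow> y i \<le> 1) \<and> (\<forall>i. 1 \<le> i \<and> i \<le> d \<longrightarrow> - y i \<le> 1) \<and>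
        (\<forall>i j. 1 \<le> i \<and> i < j \<and> j \<le> d \<longrightarrow> (\<Sum>l=i..j. y l) \<le> 1)"
      by (simp only: e n s cong: conj_cong imp_cong)
    finally show ?thesis
      by (auto simp: minus_le_iff)
  qed
  then show ?thesis
    unfolding stasheff_def polar_dual_hull by (simp add: stasheff_dual_def polar_dual_def)
qed

end

theory Submission
  imports Defs
begin

text \<open>
  Build a lattice point of the \<open>n\<close>-th dilate one coordinate at a time, remembering only the largest
  sum \<open>t \<ge> 0\<close> of a (possibly empty) block of consecutive coordinates adjacent to the position to be
  filled next. The number of completions of length \<open>d\<close> is then affine in \<open>t\<close>, of the form
  \<open>A\<^sub>d - t A\<^sub>d\<^sub>-\<^sub>1\<close>, whence with \<open>a = n\<close> and \<open>b = n + 1\<close>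

    \<open>A\<^sub>d\<^sub>+\<^sub>2 = (a + b) A\<^sub>d\<^sub>+\<^sub>1 - \<onehalf> a b A\<^sub>d\<close>.

  This is homogeneous in \<open>a, b\<close>. Putting \<open>D\<^sub>d = A\<^sub>d\<^sub>+\<^sub>1 - a A\<^sub>d\<close> turns it into the subtraction-free
  system \<open>D\<^sub>d\<^sub>+\<^sub>1 = b D\<^sub>d + \<onehalf> a b A\<^sub>d\<close>, \<open>A\<^sub>d\<^sub>+\<^sub>1 = a A\<^sub>d + D\<^sub>d\<close>, so all coefficients with respect to
  the monomials \<open>a\<^sup>i b\<^sup>d\<^sup>-\<^sup>i\<close> are nonnegative.
\<close>

section \<open>Closure properties of magic positivity\<close>

text \<open>Every basis polynomial has degree at most \<open>i + (d - i) = d\<close>, so the degree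
  condition follows from the expansion itself.\<close>

lemma magic_positiveI:
  assumes "f = (\<Sum>i\<le>d. smult (a i) (monom 1 i * [:1, 1:] ^ (d - i)))" "\<And>i. i \<le> d \<Longrightarrow> a i \<ge> 0"
  shows "magic_positive d f"
proof -
  have "degree (smult (a i) (monom 1 i * [:1, 1:] ^ (d - i))) \<le> d" if "i \<le> d" for i
  proof -
    have "degree (smult (a i) (monom 1 i * [:1, 1:] ^ (d - i)))
        \<le> degree (monom 1 i * [:1, 1:] ^ (d - i) :: real poly)"
      by (rule degree_smult_le)
    also have "\<dots> \<le> degree (monom 1 i :: real poly) + degree ([:1, 1:] ^ (d - i) :: real poly)"
      by (rule degree_mult_le)
    also have "\<dots> \<le> i + (d - i)"
      using degree_power_le[of "[:1, 1:] :: real poly" "d - i"]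
      by (intro add_mono degree_monom_le) simp
    finally show ?thesis
      using that by simp
  qed
  then have "degree f \<le> d"
    unfolding assms(1) by (intro degree_sum_le) auto
  then show ?thesis
    using assms unfolding magic_positive_def by blast
qed

lemma magic_positiveE:
  assumes "magic_positive d f"
  obtains a where "f = (\<Sum>i\<le>d. smult (a i) (monom 1 i * [:1, 1:] ^ (d - i)))"
    "\<And>i. i \<le> d \<Longrightarrow> a i \<ge> 0"
  using assms unfolding magic_positive_def by blast

lemma magic_positive_1: "magic_positive 0 1"
  by (rule magic_positiveI[where a = "\<lambda>_. 1"]) simp_all

lemma magic_positive_add:
  assumes "magic_positive d f" "magic_positive d g"
  shows "magic_positive d (f + g)"
proof -
  obtain a where a: "f = (\<Sum>i\<le>d. smult (a i) (monom 1 i * [:1, 1:] ^ (d - i)))"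
      "\<And>i. i \<le> d \<Longrightarrow> a i \<ge> 0"
    using assms(1) by (rule magic_positiveE) blast
  obtain b where b: "g = (\<Sum>i\<le>d. smult (b i) (monom 1 i * [:1, 1:] ^ (d - i)))"
      "\<And>i. i \<le> d \<Longrightarrow> b i \<ge> 0"
    using assms(2) by (rule magic_positiveE) blast
  show ?thesis
    by (rule magic_positiveI[where a = "\<lambda>i. a i + b i"])
      (use a b in \<open>simp_all only: smult_add_left sum.distrib add_nonneg_nonneg\<close>)
qed

lemma magic_positive_smult:
  assumes "magic_positive d f" "c \<ge> 0"
  shows "magic_positive d (smult c f)"
proof -
  obtain a where a: "f = (\<Sum>i\<le>d. smult (a i) (monom 1 i * [:1, 1:] ^ (d - i)))"
      "\<And>i. i \<le> d \<Longrightarrow> a i \<ge> 0"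
    using assms(1) by (rule magic_positiveE) blast
  show ?thesis
    by (rule magic_positiveI[where a = "\<lambda>i. c * a i"])
      (use a(2) assms(2) in \<open>simp_all add: a(1) poly_eq_iff coeff_sum sum_distrib_left mult.assoc\<close>)
qed

text \<open>Since \<open>d - i = Suc d - Suc i\<close>, multiplication by the variable shifts the
  coefficients up by one index and puts 0 at index 0.\<close>

lemma magic_positive_mult_X:
  assumes "magic_positive d f"
  shows "magic_positive (Suc d) ([:0, 1:] * f)"
proof -
  obtain a where a: "f = (\<Sum>i\<le>d. smult (a i) (monom 1 i * [:1, 1:] ^ (d - i)))"
      "\<And>i. i \<le> d \<Longrightarrow> a i \<ge> 0"
    using assms by (rule magic_positiveE) blast
  show ?thesis
  proof (rule magic_positiveI[where a = "\<lambda>i. if i = 0 then 0 else a (i - 1)"])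
    have "[:0, 1:] * f = (\<Sum>i\<le>d. smult (a i) (monom 1 (Suc i) * [:1, 1:] ^ (d - i)))"
      unfolding a(1) sum_distrib_left
      by (rule sum.cong) (simp_all add: monom_Suc)
    then show "[:0, 1:] * f = (\<Sum>i\<le>Suc d. smult (if i = 0 then 0 else a (i - 1))
        (monom 1 i * [:1, 1:] ^ (Suc d - i)))"
      by (simp add: sum.atMost_Suc_shift del: sum.atMost_Suc)
  qed (use a(2) in auto)
qed

text \<open>Here only the exponent \<open>d - i\<close> grows: the coefficients keep their indices,
  and the new top one is 0.\<close>

lemma magic_positive_mult_Suc_X:
  assumes "magic_positive d f"
  shows "magic_positive (Suc d) ([:1, 1:] * f)"
proof -
  obtain a where a: "f = (\<Sum>i\<le>d. smult (a i) (monom 1 i * [:1, 1:] ^ (d - i)))"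
      "\<And>i. i \<le> d \<Longrightarrow> a i \<ge> 0"
    using assms by (rule magic_positiveE) blast
  show ?thesis
  proof (rule magic_positiveI[where a = "\<lambda>i. if i \<le> d then a i else 0"])
    have "[:1, 1:] * f = (\<Sum>i\<le>d. smult (a i) (monom 1 i * [:1, 1:] ^ (Suc d - i)))"
      unfolding a(1) sum_distrib_left
      by (rule sum.cong) (simp_all add: Suc_diff_le mult.left_commute del: mult_pCons_left)
    then show "[:1, 1:] * f = (\<Sum>i\<le>Suc d. smult (if i \<le> d then a i else 0)
        (monom 1 i * [:1, 1:] ^ (Suc d - i)))"
      by simp
  qed (use a(2) in auto)
qed

section \<open>The three-term recursion and its positivity\<close>

fun stasheff_poly :: "nat \<Rightarrow> real poly" where
  "stasheff_poly 0 = 1"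
| "stasheff_poly (Suc 0) = [:1, 2:]"
| "stasheff_poly (Suc (Suc d)) = [:1, 2:] * stasheff_poly (Suc d)
     - smult (1/2) ([:0, 1:] * ([:1, 1:] * stasheff_poly d))"

text \<open>The recursion contains a subtraction, so induction on the first conjunct alone would not
  go through. The second conjunct carries the difference \<open>D\<close> along.\<close>

lemma magic_positive_stasheff_poly:
  "magic_positive d (stasheff_poly d) \<and>
   magic_positive (Suc d) (stasheff_poly (Suc d) - [:0, 1:] * stasheff_poly d)"
proof (induction d)
  case 0
  have "magic_positive (Suc 0) ([:1, 1:] * 1)"
    by (intro magic_positive_mult_Suc_X magic_positive_1)
  then show ?case
    by (simp add: magic_positive_1)
next
  case (Suc d)
  define A D where "A = stasheff_poly d" and
    "D = stasheff_poly (Suc d) - [:0, 1:] * stasheff_poly d"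
  have A: "magic_positive d A" and D: "magic_positive (Suc d) D"
    using Suc.IH by (auto simp: A_def D_def)
  have A': "stasheff_poly (Suc d) = [:0, 1:] * A + D"
    by (simp only: A_def D_def algebra_simps)
  have X: "[:1, 2:] = [:0, 1:] + ([:1, 1:] :: real poly)"
    by simp
  have half: "smult (1/2) p + smult (1/2) p = p" for p :: "real poly"
    by (simp flip: smult_add_left)
  have "stasheff_poly (Suc (Suc d)) - [:0, 1:] * stasheff_poly (Suc d)
      = [:1, 1:] * D + ([:0, 1:] * ([:1, 1:] * A) - smult (1/2) ([:0, 1:] * ([:1, 1:] * A)))"
    unfolding stasheff_poly.simps(3) A' X A_def[symmetric]
    by (simp only: algebra_simps)
  \<comment> \<open>The product of \<open>b\<close> with the summand \<open>a A\<close> of the next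
    polynomial yields \<open>a b A\<close>; the recursion removes only half of it.\<close>
  also have "\<dots> = [:1, 1:] * D + smult (1/2) ([:0, 1:] * ([:1, 1:] * A))"
    using half[of "[:0, 1:] * ([:1, 1:] * A)"] by (simp only: algebra_simps)
  finally have D': "stasheff_poly (Suc (Suc d)) - [:0, 1:] * stasheff_poly (Suc d) = \<dots>" .
  show ?case
    unfolding D' unfolding A'
    by (intro conjI magic_positive_add magic_positive_smult magic_positive_mult_X
        magic_positive_mult_Suc_X A D) simp
qed

section \<open>Counting integer points coordinate by coordinate\<close>

text \<open>The coordinates are filled from right to left: \<open>t\<close> stands for the largest sum of a block
  starting at position \<open>d + 1\<close>.\<close>

definition stasheff_points :: "int \<Rightarrow> int \<Rightarrow> nat \<Rightarrow> (nat \<Rightarrow> int) set" where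
  "stasheff_points n t d = {y. (\<forall>i. i \<notin> {1..d} \<longrightarrow> y i = 0) \<and> (\<forall>i\<in>{1..d}. - n \<le> y i) \<and>
     (\<forall>j k. 1 \<le> j \<and> j \<le> k \<and> k \<le> d \<longrightarrow> (\<Sum>i=j..k. y i) \<le> n) \<and>
     (\<forall>j. 1 \<le> j \<and> j \<le> d \<longrightarrow> (\<Sum>i=j..d. y i) \<le> n - t)}"

lemma finite_stasheff_points: "finite (stasheff_points n t d)"
proof (rule finite_subset)
  show "stasheff_points n t d
      \<subseteq> {y. \<forall>i. (i \<in> {1..d} \<longrightarrow> y i \<in> {-n..n}) \<and> (i \<notin> {1..d} \<longrightarrow> y i = 0)}"
  proof
    fix y assume y: "y \<in> stasheff_points n t d"
    have "y i \<le> n" if "i \<in> {1..d}" for i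
    proof -
      have "(\<Sum>l=i..i. y l) \<le> n"
        using y that unfolding stasheff_points_def mem_Collect_eq atLeastAtMost_iff by blast
      then show ?thesis
        by simp
    qed
    then show "y \<in> {y. \<forall>i. (i \<in> {1..d} \<longrightarrow> y i \<in> {-n..n}) \<and> (i \<notin> {1..d} \<longrightarrow> y i = 0)}"
      using y by (auto simp: stasheff_points_def)
  qed
qed (rule finite_set_of_finite_funs; simp)

text \<open>A block starting at \<open>Suc d\<close> is empty or consists of \<open>x\<close>
  followed by a block counted in \<open>t\<close>, so the new largest sum is
  \<open>max 0 (t + x)\<close>. Requiring \<open>y (Suc d) = 0\<close> makes \<open>y\<close>
  recoverable from the updated function.\<close>

lemma fun_upd_mem_stasheff_points_Suc:
  assumes "0 \<le> t"
  shows "y(Suc d := x) \<in> stasheff_points n t (Suc d) \<and> y (Suc d) = 0 \<longleftrightarrow>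
    x \<in> {-n..n - t} \<and> y \<in> stasheff_points n (max 0 (t + x)) d"
    (is "?L \<longleftrightarrow> ?R")
proof -
  have sum_le: "(\<Sum>i=j..k. (y(Suc d := x)) i) = (\<Sum>i=j..k. y i)" if "k \<le> d" for j k
    using that by (intro sum.cong) auto
  have sum_Suc: "(\<Sum>i=j..Suc d. (y(Suc d := x)) i) = (\<Sum>i=j..d. y i) + x" if "j \<le> Suc d" for j
    using that sum_le[of d j] by simp
  show ?thesis
  proof
    assume L: ?L
    have "(\<Sum>i=j..k. y i) \<le> n" if "1 \<le> j" "j \<le> k" "k \<le> d" for j k
    proof -
      have "(\<Sum>i=j..k. (y(Suc d := x)) i) \<le> n"
        using L that unfolding stasheff_points_def mem_Collect_eq by (meson le_SucI)
      then show ?thesis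
        using sum_le that by simp
    qed
    moreover have suffix: "(\<Sum>i=j..d. y i) + x \<le> n - t" if "1 \<le> j" "j \<le> Suc d" for j
      using L that sum_Suc[of j] unfolding stasheff_points_def mem_Collect_eq by metis
    \<comment> \<open>For \<open>j = Suc d\<close> the remaining sum is empty.\<close>
    moreover have "x \<le> n - t"
      using suffix[of "Suc d"] by simp
    moreover have "- n \<le> (y(Suc d := x)) i" if "i \<in> {1..Suc d}" for i
      using L that unfolding stasheff_points_def by blast
    then have "- n \<le> x" "\<And>i. i \<in> {1..d} \<Longrightarrow> - n \<le> y i"
      by (force, fastforce split: if_splits)
    moreover have "y i = 0" if "i \<notin> {1..d}" for i
    proof (cases "i = Suc d")
      case False
      then have "(y(Suc d := x)) i = 0"
        using L that False unfolding stasheff_points_def mem_Collect_eq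
        by (metis atLeastAtMost_iff le_SucE)
      with False show ?thesis
        by simp
    qed (use L in simp)
    ultimately show ?R
      by (fastforce simp: stasheff_points_def max_def)
  next
    assume R: ?R
    have suffix: "(\<Sum>i=j..d. y i) + x \<le> n - t" if "1 \<le> j" "j \<le> Suc d" for j
    proof (cases "j = Suc d")
      case False
      then have "(\<Sum>i=j..d. y i) \<le> n - max 0 (t + x)"
        using R that unfolding stasheff_points_def by auto
      then show ?thesis
        by linarith
    qed (use R in simp)
    have "(\<Sum>i=j..k. (y(Suc d := x)) i) \<le> n" if "1 \<le> j" "j \<le> k" "k \<le> Suc d" for j k
    proof (cases "k = Suc d")
      case True
      \<comment> \<open>A block ending at \<open>Suc d\<close> is at most \<open>n - t\<close>,
        which is at most \<open>n\<close> because \<open>t\<close> is nonnegative.\<close>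
      then show ?thesis
        using suffix[of j] sum_Suc[of j] that assms by simp
    next
      case False
      then show ?thesis
        using R that sum_le[of k j] unfolding stasheff_points_def by auto
    qed
    moreover have "(\<Sum>i=j..Suc d. (y(Suc d := x)) i) \<le> n - t" if "1 \<le> j" "j \<le> Suc d" for j
      using suffix[of j] sum_Suc[of j] that by simp
    moreover have "y (Suc d) = 0"
      using R by (auto simp: stasheff_points_def)
    ultimately show ?L
      using R unfolding stasheff_points_def by auto
  qed
qed

text \<open>The points are fibred over their last coordinate; resetting it to 0 inverts the
  update.\<close>

lemma card_stasheff_points_Suc:
  assumes "0 \<le> t"
  shows "card (stasheff_points n t (Suc d))
    = (\<Sum>x\<in>{-n..n - t}. card (stasheff_points n (max 0 (t + x)) d))"
proof -
  let ?S = "SIGMA x:{-n..n - t}. stasheff_points n (max 0 (t + x)) d"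
  have "bij_betw (\<lambda>(x, y). y(Suc d := x)) ?S (stasheff_points n t (Suc d))"
  proof (rule bij_betw_byWitness[where f' = "\<lambda>y. (y (Suc d), y(Suc d := 0))"])
    show "\<forall>p\<in>?S. (\<lambda>y. (y (Suc d), y(Suc d := 0))) ((\<lambda>(x, y). y(Suc d := x)) p) = p"
      by (auto simp: stasheff_points_def fun_upd_idem)
    show "(\<lambda>(x, y). y(Suc d := x)) ` ?S \<subseteq> stasheff_points n t (Suc d)"
      using fun_upd_mem_stasheff_points_Suc[OF assms] by fast
    show "(\<lambda>y. (y (Suc d), y(Suc d := 0))) ` stasheff_points n t (Suc d) \<subseteq> ?S"
    proof
      fix p assume "p \<in> (\<lambda>y. (y (Suc d), y(Suc d := 0))) ` stasheff_points n t (Suc d)"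
      then obtain y where "y \<in> stasheff_points n t (Suc d)" "p = (y (Suc d), y(Suc d := 0))"
        by blast
      then show "p \<in> ?S"
        using fun_upd_mem_stasheff_points_Suc[OF assms, of "y(Suc d := 0)" d "y (Suc d)" n]
        by simp
    qed
  qed simp
  then have "card (stasheff_points n t (Suc d)) = card ?S"
    by (simp add: bij_betw_same_card)
  then show ?thesis
    by (simp add: finite_stasheff_points)
qed

lemma sum_of_int_gauss: "(\<Sum>s=1..int n. real_of_int s) = real n * (real n + 1) / 2"
proof (induction n)
  case (Suc n)
  have "{1..int (Suc n)} = insert (int (Suc n)) {1..int n}"
    by auto
  then show ?case
    using Suc by (simp add: field_simps)
qed simp

text \<open>Of the values \<open>s = t + x\<close>, the nonpositive ones all lead to the state 0,
  and there are \<open>n - t + 1\<close> of them. The positive ones run over \<open>1..n\<close> for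
  every \<open>t\<close>, so the count is affine in \<open>t\<close>.\<close>

lemma card_stasheff_points_Suc_split:
  assumes "0 \<le> t" "t \<le> int n"
  shows "real (card (stasheff_points (int n) t (Suc d)))
    = (real n - real_of_int t + 1) * real (card (stasheff_points (int n) 0 d))
      + (\<Sum>s=1..int n. real (card (stasheff_points (int n) s d)))"
proof -
  let ?c = "\<lambda>s. card (stasheff_points (int n) (max 0 s) d)"
  have "card (stasheff_points (int n) t (Suc d)) = (\<Sum>x\<in>{- int n..int n - t}. ?c (t + x))"
    using assms(1) by (rule card_stasheff_points_Suc)
  also have "\<dots> = (\<Sum>s\<in>{t - int n..int n}. ?c s)"
    by (rule sum.reindex_bij_witness[of _ "\<lambda>s. s - t" "\<lambda>x. t + x"]) auto
  \<comment> \<open>The cut at 0 is legitimate because \<open>t - n \<le> 0\<close>.\<close>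
  also have "{t - int n..int n} = {t - int n..0} \<union> {1..int n}"
    using assms by auto
  also have "sum ?c \<dots> = (\<Sum>s\<in>{t - int n..0}. ?c s) + (\<Sum>s=1..int n. ?c s)"
    by (rule sum.union_disjoint) auto
  also have "(\<Sum>s\<in>{t - int n..0}. ?c s) = (\<Sum>s\<in>{t - int n..0}. card (stasheff_points (int n) 0 d))"
    by (rule sum.cong) (auto simp: max_def)
  also have "(\<Sum>s=1..int n. ?c s) = (\<Sum>s=1..int n. card (stasheff_points (int n) s d))"
    by (rule sum.cong) (auto simp: max_def)
  finally show ?thesis
    using assms by (simp add: of_nat_nat)
qed

lemma card_stasheff_points_0: "card (stasheff_points n t 0) = 1"
proof -
  have "stasheff_points n t 0 = {\<lambda>_. 0}"
    by (auto simp: stasheff_points_def)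
  then show ?thesis
    by simp
qed

text \<open>The affine form is preserved by the splitting formula. It is stated from dimension one
  on, because the slope refers to the preceding polynomial; \<open>t\<close> stays arbitrary since
  the step sums over all states.\<close>

lemma card_stasheff_points:
  assumes "0 \<le> t" "t \<le> int n"
  shows "real (card (stasheff_points (int n) t (Suc d)))
    = poly (stasheff_poly (Suc d)) (real n) - real_of_int t * poly (stasheff_poly d) (real n)"
  using assms
proof (induction d arbitrary: t)
  case 0
  then show ?case
    by (simp add: card_stasheff_points_Suc_split card_stasheff_points_0)
next
  case (Suc d)
  let ?A = "\<lambda>k. poly (stasheff_poly k) (real n)"
  have "(\<Sum>s=1..int n. real (card (stasheff_points (int n) s (Suc d))))
      = (\<Sum>s=1..int n. ?A (Suc d) - real_of_int s * ?A d)"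
    using Suc.IH by (intro sum.cong) auto
  \<comment> \<open>The sum of the states gives \<open>n (n + 1) / 2\<close>, the source of the
    factor \<open>a b / 2\<close> in the recursion.\<close>
  also have "\<dots> = real n * ?A (Suc d) - real n * (real n + 1) / 2 * ?A d"
    by (simp add: sum_subtractf sum_of_int_gauss flip: sum_distrib_right)
  finally show ?case
    using Suc.IH[of 0] Suc.prems
    by (simp add: card_stasheff_points_Suc_split algebra_simps add_divide_distrib)
qed

section \<open>From the dilated polytope to integer points\<close>

text \<open>Dividing by \<open>c\<close> reduces this to the polytope itself. The upper bounds on
  single coordinates become the blocks with \<open>j = k\<close>, matching
  \<open>stasheff_points\<close>.\<close>

lemma mem_dilate_stasheff_dual_iff:
  assumes "c > 0"
  shows "y \<in> dilate c (stasheff_dual d) \<longleftrightarrow> y \<in> Rspace d \<and> (\<forall>i\<in>{1..d}. - c \<le> y i) \<and>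
    (\<forall>j k. 1 \<le> j \<and> j \<le> k \<and> k \<le> d \<longrightarrow> (\<Sum>i=j..k. y i) \<le> c)"
proof -
  have "y \<in> dilate c (stasheff_dual d) \<longleftrightarrow> (\<lambda>i. y i / c) \<in> stasheff_dual d"
  proof
    assume "y \<in> dilate c (stasheff_dual d)"
    then show "(\<lambda>i. y i / c) \<in> stasheff_dual d"
      using assms by (auto simp: dilate_def)
  next
    assume "(\<lambda>i. y i / c) \<in> stasheff_dual d"
    then have "(\<lambda>i. c * (y i / c)) \<in> dilate c (stasheff_dual d)"
      unfolding dilate_def by (rule rev_image_eqI) simp
    then show "y \<in> dilate c (stasheff_dual d)"
      using assms by simp
  qed
  also have "\<dots> \<longleftrightarrow> y \<in> Rspace d \<and> (\<forall>i\<in>{1..d}. - c \<le> y i \<and> y i \<le> c) \<and>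
    (\<forall>j k. 1 \<le> j \<and> j < k \<and> k \<le> d \<longrightarrow> (\<Sum>i=j..k. y i) \<le> c)"
    using assms by (auto simp: stasheff_dual_def Rspace_def field_simps simp flip: sum_divide_distrib)
  also have "\<dots> \<longleftrightarrow> y \<in> Rspace d \<and> (\<forall>i\<in>{1..d}. - c \<le> y i) \<and>
    (\<forall>j k. 1 \<le> j \<and> j \<le> k \<and> k \<le> d \<longrightarrow> (\<Sum>i=j..k. y i) \<le> c)"
    (is "_ \<and> ?P \<and> ?Q \<longleftrightarrow> _ \<and> ?P' \<and> ?Q'")
  proof -
    have "?P \<and> ?Q" if "?P'" "?Q'"
    proof -
      have "y i \<le> c" if "i \<in> {1..d}" for i
        using \<open>?Q'\<close>[rule_format, of i i] that by simp
      then show ?thesis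
        using that by simp
    qed
    moreover have "?P' \<and> ?Q'" if "?P" "?Q"
    proof -
      have "(\<Sum>i=j..k. y i) \<le> c" if "1 \<le> j" "j \<le> k" "k \<le> d" for j k
        using that \<open>?P\<close> \<open>?Q\<close> by (cases "j = k") simp_all
      then show ?thesis
        using that by blast
    qed
    ultimately show ?thesis
      by blast
  qed
  finally show ?thesis .
qed

text \<open>For \<open>t = 0\<close> the suffix bounds in \<open>stasheff_points\<close> are block
  bounds with \<open>k = d\<close>, so only the inequalities of the dilate remain.\<close>

lemma dilate_stasheff_dual_lattice_eq:
  assumes "n > 0"
  shows "dilate (real n) (stasheff_dual d) \<inter> Zlattice d
    = (\<lambda>y i. real_of_int (y i)) ` stasheff_points (int n) 0 d"
proof -
  have sum_z: "(\<Sum>i=j..k. real_of_int (z i)) \<le> real n \<longleftrightarrow> (\<Sum>i=j..k. z i) \<le> int n"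
    for j k and z :: "nat \<Rightarrow> int"
    by (metis of_int_le_iff of_int_of_nat_eq of_int_sum)
  show ?thesis
  proof (intro set_eqI iffI)
    fix y assume y: "y \<in> dilate (real n) (stasheff_dual d) \<inter> Zlattice d"
    define z where "z = (\<lambda>i. \<lfloor>y i\<rfloor>)"
    have yz: "y = (\<lambda>i. real_of_int (z i))"
    proof
      fix i
      have "y i \<in> \<int>"
        using y by (cases "i \<in> {1..d}") (auto simp: Zlattice_def Rspace_def)
      then show "y i = real_of_int (z i)"
        by (auto simp: z_def elim: Ints_cases)
    qed
    have "z \<in> stasheff_points (int n) 0 d"
      using y assms unfolding yz
      by (auto simp: mem_dilate_stasheff_dual_iff stasheff_points_def Rspace_def sum_z)
    then show "y \<in> (\<lambda>y i. real_of_int (y i)) ` stasheff_points (int n) 0 d"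
      using yz by blast
  next
    fix y assume "y \<in> (\<lambda>y i. real_of_int (y i)) ` stasheff_points (int n) 0 d"
    then obtain z where z: "z \<in> stasheff_points (int n) 0 d" "y = (\<lambda>i. real_of_int (z i))"
      by blast
    then show "y \<in> dilate (real n) (stasheff_dual d) \<inter> Zlattice d"
      using assms
      by (auto simp: mem_dilate_stasheff_dual_iff stasheff_points_def Rspace_def Zlattice_def sum_z)
  qed
qed

lemma is_ehrhart_polynomial_stasheff_poly:
  "is_ehrhart_polynomial d (stasheff_dual d) (stasheff_poly d)"
  unfolding is_ehrhart_polynomial_def
proof (intro allI impI)
  fix n :: nat assume n: "n > 0"
  have "inj_on (\<lambda>y i. real_of_int (y i)) (stasheff_points (int n) 0 d)"
    by (auto simp: inj_on_def fun_eq_iff)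
  then have "card (dilate (real n) (stasheff_dual d) \<inter> Zlattice d)
      = card (stasheff_points (int n) 0 d)"
    using n by (simp add: dilate_stasheff_dual_lattice_eq card_image)
  \<comment> \<open>At \<open>t = 0\<close> the slope term vanishes. Dimension 0, with its single
    point, is treated separately because the affine formula starts in dimension one.\<close>
  moreover have "real (card (stasheff_points (int n) 0 d)) = poly (stasheff_poly d) (real n)"
    by (cases d) (simp_all add: card_stasheff_points card_stasheff_points_0 del: stasheff_poly.simps(3))
  ultimately show "poly (stasheff_poly d) (real n)
      = real (card (dilate (real n) (stasheff_dual d) \<inter> Zlattice d))"
    by simp
qed

theorem theorem1p3:
  fixes d :: nat
  assumes "d \<ge> 1"
  shows "magic_positive d (ehrhart_polynomial d (stasheff_dual d))"
  using magic_positive_stasheff_poly[of d]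
    ehrhart_polynomial_eqI[OF is_ehrhart_polynomial_stasheff_poly[of d]]
  by simp

end
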